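(* Let $m \ge 1$ and $n \ge 2$ be integers, and let $R(x,y) = R_{C(2m+1,-2n)}(x,y)$ be the Riley polynomial of $C(2m+1,-2n)$, i.e. $R(x,y) = S_{n}(t) - z\,S_{n-1}(t)$ with $$t = 2 - (y+2-x)(S_m(y)-S_{m-1}(y))^2, \qquad z = 1 - (y+2-x)S_m(y)\,(S_m(y)-S_{m-1}(y)).$$ Then there exists a unique continuous real function $x \colon (2\cos\frac{\pi}{2m+1},\infty) \to (0,\infty)$ in the variable $y$ such that $R(x(y),y)=0$ and $x(y)>y+2$ for all $y > 2\cos\frac{\pi}{2m+1}$.
   Context: The Chebyshev polynomials $S_j(v)$, $j \in \mathbb{Z}$, are defined by $S_0(v)=1$, $S_1(v)=v$ and $S_j(v) = vS_{j-1}(v)-S_{j-2}(v)$ for all integers $j$. $C(2m+1,-2n)$ is a two-bridge knot in Conway notation; the zero locus of its Riley polynomial, with $x$ the square of the trace of a meridian, describes the nonabelian $\mathrm{SL}_2(\mathbb{C})$-representations of its knot group. Only the explicit formula for $R(x,y)$ is needed for the statement. *)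

theory Defs
  imports Complex_Main "HOL-Library.FuncSet"
begin

text \<open>
  The Chebyshev polynomials \<open>S\<^sub>j(v)\<close> for all integers \<open>j\<close>. For negative \<open>j\<close> the
  recurrence is run downwards; \<open>chebyshev_S_rec\<close> below gives it for every \<open>j\<close>.
\<close>
function chebyshev_S :: "int \<Rightarrow> 'a::comm_ring_1 \<Rightarrow> 'a" where
  "chebyshev_S j v =
     (if j = 0 then 1
      else if j = 1 then v
      else if j > 1 then v * chebyshev_S (j - 1) v - chebyshev_S (j - 2) v
      else v * chebyshev_S (j + 1) v - chebyshev_S (j + 2) v)"
  by auto
termination
  by (relation "Wellfounded.measure (\<lambda>(j, v). nat (if j \<ge> 0 then j else 2 - j))") auto

declare chebyshev_S.simps [simp del]

lemma chebyshev_S_0 [simp]: "chebyshev_S 0 v = 1"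
  by (simp add: chebyshev_S.simps)

lemma chebyshev_S_1 [simp]: "chebyshev_S 1 v = v"
  by (simp add: chebyshev_S.simps)

lemma chebyshev_S_rec: "chebyshev_S j v = v * chebyshev_S (j - 1) v - chebyshev_S (j - 2) v"
proof (cases "j > 1")
  case True
  then show ?thesis by (subst chebyshev_S.simps) simp
next
  case False
  then have "chebyshev_S (j - 2) v = v * chebyshev_S (j - 1) v - chebyshev_S j v"
    by (subst chebyshev_S.simps) simp
  then show ?thesis by simp
qed

text \<open>The Riley polynomial \<open>R(x, y)\<close> of the two-bridge knot \<open>C(2m+1, -2n)\<close>.\<close>
definition riley_t :: "int \<Rightarrow> 'a::comm_ring_1 \<Rightarrow> 'a \<Rightarrow> 'a" where
  "riley_t m x y = 2 - (y + 2 - x) * (chebyshev_S m y - chebyshev_S (m - 1) y)\<^sup>2"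

definition riley_z :: "int \<Rightarrow> 'a::comm_ring_1 \<Rightarrow> 'a \<Rightarrow> 'a" where
  "riley_z m x y =
     1 - (y + 2 - x) * chebyshev_S m y * (chebyshev_S m y - chebyshev_S (m - 1) y)"

definition riley_poly :: "int \<Rightarrow> int \<Rightarrow> 'a::comm_ring_1 \<Rightarrow> 'a \<Rightarrow> 'a" where
  "riley_poly m n x y =
     chebyshev_S n (riley_t m x y) - riley_z m x y * chebyshev_S (n - 1) (riley_t m x y)"

end

theory Submission
  imports Defs
begin

text \<open>
  Fix \<open>y > 2 cos (\<pi> / (2m+1))\<close>, write \<open>b = S\<^sub>m\<^sub>-\<^sub>1(y)\<close> and \<open>d = S\<^sub>m(y) - b\<close>, and replace \<open>x\<close> by
  \<open>s = (x - y - 2) d\<^sup>2\<close>. Then \<open>t = 2 + s\<close>, and since \<open>S\<^sub>m(y) = b + d\<close> the recurrence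
  for \<open>S\<^sub>n(t)\<close> gives
  \<open>d R = d (S\<^sub>n\<^sub>-\<^sub>1(t) - S\<^sub>n\<^sub>-\<^sub>2(t)) - b s S\<^sub>n\<^sub>-\<^sub>1(t)\<close>.
  The largest root of \<open>S\<^sub>m - S\<^sub>m\<^sub>-\<^sub>1\<close> is \<open>2 cos (\<pi> / (2m+1))\<close>, and \<open>S\<^sub>m\<^sub>-\<^sub>1\<close> has no root to the
  right of it; so \<open>b\<close> and \<open>d\<close> are positive (\<open>chebyshev_S_pos_right_of_root\<close>). For \<open>x > y + 2\<close>
  the equation \<open>R = 0\<close> therefore separates the variables: it reads \<open>h\<^sub>n(s) = d / b\<close>, where
  \<open>h\<^sub>n(s) = s S\<^sub>n\<^sub>-\<^sub>1(s+2) / (S\<^sub>n\<^sub>-\<^sub>1(s+2) - S\<^sub>n\<^sub>-\<^sub>2(s+2))\<close> depends on \<open>s\<close> alone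
  (\<open>riley_poly_eq_0_iff\<close>).

  The functions \<open>h\<^sub>k\<close> satisfy \<open>h\<^sub>0 = 0\<close> and \<open>h\<^sub>k\<^sub>+\<^sub>1(s) = s + h\<^sub>k(s) / (1 + h\<^sub>k(s))\<close>. As
  \<open>v / (1 + v)\<close> increases with \<open>v \<ge> 0\<close>, every \<open>h\<^sub>k\<close> with \<open>k \<ge> 1\<close> is continuous and strictly
  increasing on \<open>[0, \<infinity>)\<close>, vanishes at \<open>0\<close> and satisfies \<open>h\<^sub>k(s) \<ge> s\<close>; it is a homeomorphism
  of \<open>(0, \<infinity>)\<close>. Hence \<open>x(y) = y + 2 + h\<^sub>n\<inverse>(d / b) / d\<^sup>2\<close> is the only solution, and
  it is continuous in \<open>y\<close>.
\<close>

section \<open>The ratio of Chebyshev polynomials and its inverse\<close>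

text \<open>
  The function \<open>h\<^sub>k\<close> as a continued fraction. In this form, unlike in the form of a quotient of
  polynomials, monotonicity in \<open>s\<close> is visible.
\<close>
primrec chebyshev_ratio :: "nat \<Rightarrow> real \<Rightarrow> real" where
  "chebyshev_ratio 0 s = 0"
| "chebyshev_ratio (Suc k) s = s + chebyshev_ratio k s / (1 + chebyshev_ratio k s)"

lemma chebyshev_ratio_nonneg: "s \<ge> 0 \<Longrightarrow> chebyshev_ratio k s \<ge> 0"
  by (induction k) auto

lemma chebyshev_ratio_at_0 [simp]: "chebyshev_ratio k 0 = 0"
  by (induction k) auto

lemma chebyshev_ratio_ge: "s \<ge> 0 \<Longrightarrow> k > 0 \<Longrightarrow> chebyshev_ratio k s \<ge> s"
  using chebyshev_ratio_nonneg[of s "k - 1"] by (cases k) auto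

lemma chebyshev_S_pred: "chebyshev_S (-1) v = 0" "chebyshev_S (-2) v = -1"
proof -
  show "chebyshev_S (-1) v = 0"
    using chebyshev_S_rec[of 1 v] by simp
  then have "- chebyshev_S (-2) v = 1"
    using chebyshev_S_rec[of 0 v] by simp
  then show "chebyshev_S (-2) v = -1"
    by (metis minus_minus)
qed

text \<open>
  With \<open>D\<^sub>k = S\<^sub>k\<^sub>-\<^sub>1 - S\<^sub>k\<^sub>-\<^sub>2\<close> and \<open>E\<^sub>k = s S\<^sub>k\<^sub>-\<^sub>1\<close>, the Chebyshev recurrence at \<open>s + 2\<close> becomes
  \<open>D\<^sub>k\<^sub>+\<^sub>1 = D\<^sub>k + E\<^sub>k\<close> and \<open>E\<^sub>k\<^sub>+\<^sub>1 = E\<^sub>k + s D\<^sub>k\<^sub>+\<^sub>1\<close>, so all terms stay nonnegative and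
  \<open>E\<^sub>k\<^sub>+\<^sub>1 / D\<^sub>k\<^sub>+\<^sub>1 = s + E\<^sub>k / (D\<^sub>k + E\<^sub>k)\<close>, which is the recursion of the continued fraction.
\<close>
lemma chebyshev_S_ratio:
  assumes "s \<ge> 0"
  shows "chebyshev_S (int k - 1) (s + 2) \<ge> 0 \<and>
    chebyshev_S (int k - 1) (s + 2) - chebyshev_S (int k - 2) (s + 2) > 0 \<and>
    chebyshev_ratio k s * (chebyshev_S (int k - 1) (s + 2) - chebyshev_S (int k - 2) (s + 2))
      = s * chebyshev_S (int k - 1) (s + 2)"
proof (induction k)
  case 0
  then show ?case by (simp add: chebyshev_S_pred)
next
  case (Suc k)
  define p where "p = chebyshev_S (int k) (s + 2)"
  define q where "q = chebyshev_S (int k - 1) (s + 2)"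
  define r where "r = chebyshev_S (int k - 2) (s + 2)"
  define h where "h = chebyshev_ratio k s"
  have p: "p = (s + 2) * q - r"
    unfolding p_def q_def r_def by (rule chebyshev_S_rec)
  have IH: "q \<ge> 0" "q - r > 0" "h * (q - r) = s * q"
    using Suc unfolding q_def r_def h_def by auto
  have h: "h \<ge> 0"
    using chebyshev_ratio_nonneg assms unfolding h_def by blast
  have step: "p - q = (1 + h) * (q - r)"
    using IH(3) p by (simp add: algebra_simps)
  have pos: "p - q > 0"
    unfolding step using h IH(2) by simp
  have "(s + h / (1 + h)) * (p - q) = s * (p - q) + h / (1 + h) * ((1 + h) * (q - r))"
    unfolding step by (simp add: distrib_right)
  also have "h / (1 + h) * ((1 + h) * (q - r)) = h * (q - r)"
    using h by simp
  finally have "(s + h / (1 + h)) * (p - q) = s * p"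
    using IH(3) by (simp add: algebra_simps)
  moreover have "chebyshev_S (int (Suc k) - 1) (s + 2) = p"
    "chebyshev_S (int (Suc k) - 2) (s + 2) = q"
    by (simp_all add: p_def q_def)
  ultimately show ?case
    using pos IH(1) by (simp add: h_def)
qed

lemma chebyshev_ratio_mono:
  assumes "0 \<le> s" "s \<le> s'"
  shows "chebyshev_ratio k s \<le> chebyshev_ratio k s'"
proof (induction k)
  case (Suc k)
  have "chebyshev_ratio k s \<ge> 0"
    using assms chebyshev_ratio_nonneg by simp
  with Suc have "chebyshev_ratio k s / (1 + chebyshev_ratio k s)
      \<le> chebyshev_ratio k s' / (1 + chebyshev_ratio k s')"
    by (simp add: field_simps)
  then show ?case
    using assms by simp
qed simp

lemma chebyshev_ratio_strict_mono:
  assumes "0 \<le> s" "s < s'" "k > 0"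
  shows "chebyshev_ratio k s < chebyshev_ratio k s'"
proof -
  obtain j where k: "k = Suc j"
    using assms(3) by (cases k) auto
  have "chebyshev_ratio j s \<ge> 0" "chebyshev_ratio j s \<le> chebyshev_ratio j s'"
    using assms chebyshev_ratio_nonneg chebyshev_ratio_mono by simp_all
  then have "chebyshev_ratio j s / (1 + chebyshev_ratio j s)
      \<le> chebyshev_ratio j s' / (1 + chebyshev_ratio j s')"
    by (simp add: field_simps)
  then show ?thesis
    using assms(2) by (simp add: k)
qed

lemma continuous_on_chebyshev_ratio: "continuous_on {0..} (chebyshev_ratio k)"
proof (induction k)
  case (Suc k)
  have "1 + chebyshev_ratio k s \<noteq> 0" if "s \<in> {0..}" for s
    using chebyshev_ratio_nonneg[of s k] that by auto
  then show ?case
    using Suc by (auto intro!: continuous_intros)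
qed simp

lemma chebyshev_ratio_less_iff:
  assumes "s \<ge> 0" "s' \<ge> 0" "k > 0"
  shows "chebyshev_ratio k s < chebyshev_ratio k s' \<longleftrightarrow> s < s'"
  using chebyshev_ratio_strict_mono[OF assms(1) _ assms(3), of s']
    chebyshev_ratio_mono[OF assms(2), of s k] by (meson not_le)

text \<open>
  The inverse is continuous because it is monotone with an open image, so that it has no jumps.
\<close>
lemma chebyshev_ratio_inverse:
  assumes "k > 0"
  obtains g where "\<And>v. v > 0 \<Longrightarrow> g v > 0" "\<And>v. v > 0 \<Longrightarrow> chebyshev_ratio k (g v) = v"
    "continuous_on {0<..} g"
proof -
  have ex: "\<exists>s>0. chebyshev_ratio k s = v" if v: "v > 0" for v
  proof -
    \<comment> \<open>The value \<open>v\<close> is reached on \<open>[0, v]\<close>, because \<open>h\<^sub>k(0) = 0\<close> and \<open>h\<^sub>k(v) \<ge> v\<close>.\<close>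
    have "continuous_on {0..v} (chebyshev_ratio k)"
      using continuous_on_chebyshev_ratio by (rule continuous_on_subset) auto
    moreover have "v \<le> chebyshev_ratio k v"
      using chebyshev_ratio_ge v assms by simp
    ultimately obtain s where "0 \<le> s" "chebyshev_ratio k s = v"
      using IVT'[of "chebyshev_ratio k" 0 v v] v by auto
    moreover from this v have "s \<noteq> 0"
      by auto
    ultimately show ?thesis
      by (intro exI[of _ s]) auto
  qed
  then obtain g where g: "\<And>v. v > 0 \<Longrightarrow> g v > 0 \<and> chebyshev_ratio k (g v) = v"
    by metis
  have "s \<in> g ` {0<..}" if "s > 0" for s
  proof -
    have v: "chebyshev_ratio k s > 0"
      using chebyshev_ratio_ge[of s k] that assms by simp
    moreover have "g (chebyshev_ratio k s) = s"
      using g[OF v] chebyshev_ratio_less_iff[of _ _ k] that assms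
      by (metis less_irrefl less_le not_less_iff_gr_or_eq)
    ultimately show ?thesis
      by (metis greaterThan_iff image_eqI)
  qed
  then have "g ` {0<..} = {0<..}"
    using g by auto
  moreover have "g v \<le> g w" if "0 < v" "v \<le> w" for v w
    using chebyshev_ratio_less_iff[of "g w" "g v" k] g[of v] g[of w] that assms by auto
  ultimately have "continuous_on {0<..} g"
    by (intro continuous_onI_mono) auto
  with g show ?thesis
    by (intro that[of g]) auto
qed

section \<open>Chebyshev polynomials at a given point\<close>

lemma continuous_on_chebyshev_S:
  "continuous_on A (\<lambda>y :: real. chebyshev_S (int k) y) \<and>
   continuous_on A (\<lambda>y. chebyshev_S (int k - 1) y)"
proof (induction k)
  case 0
  then show ?case by (simp add: chebyshev_S_pred)
next
  case (Suc k)
  have "chebyshev_S (int (Suc k)) y = y * chebyshev_S (int k) y - chebyshev_S (int k - 1) y"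
    for y :: real
    using chebyshev_S_rec[of "int (Suc k)" y] by simp
  then show ?case
    using Suc by (auto intro!: continuous_intros)
qed

lemma sin_times_chebyshev_S:
  fixes a :: real
  shows "sin a * chebyshev_S (int k) (2 * cos a) = sin ((real k + 1) * a) \<and>
    sin a * chebyshev_S (int k - 1) (2 * cos a) = sin (real k * a)"
proof (induction k)
  case 0
  then show ?case by (simp add: chebyshev_S_pred)
next
  case (Suc k)
  have rec: "chebyshev_S (int (Suc k)) (2 * cos a)
      = 2 * cos a * chebyshev_S (int k) (2 * cos a) - chebyshev_S (int k - 1) (2 * cos a)"
    using chebyshev_S_rec[of "int (Suc k)" "2 * cos a"] by simp
  have "sin ((real (Suc k) + 1) * a) + sin (real k * a) = 2 * cos a * sin ((real k + 1) * a)"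
    using sin_add[of "(real k + 1) * a" a] sin_diff[of "(real k + 1) * a" a]
    by (simp add: algebra_simps)
  then show ?case
    using Suc unfolding rec by (simp add: algebra_simps)
qed

text \<open>
  Below \<open>2\<close> put \<open>y = 2 cos a\<close> with \<open>0 < a < \<pi> / (2m+1)\<close>: then \<open>S\<^sub>m\<^sub>-\<^sub>1(y) = sin (m a) / sin a\<close> and
  \<open>S\<^sub>m(y) - S\<^sub>m\<^sub>-\<^sub>1(y) = 2 sin (a/2) cos ((2m+1) a/2) / sin a\<close>, where all the angles lie in
  the range of positivity. From \<open>2\<close> on, the recurrence already preserves positivity.
\<close>
lemma chebyshev_S_pos_right_of_root:
  fixes y :: real
  assumes "m > 0" and y: "y > 2 * cos (pi / (2 * real m + 1))"
  shows "chebyshev_S (int m - 1) y > 0" "chebyshev_S (int m) y > chebyshev_S (int m - 1) y"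
proof -
  obtain j where m: "m = Suc j"
    using assms(1) by (cases m) auto
  have "chebyshev_S (int m - 1) y > 0 \<and> chebyshev_S (int m) y > chebyshev_S (int m - 1) y"
  proof (cases "y \<ge> 2")
    case True
    then have "chebyshev_S (int j - 1) y \<ge> 0"
      "chebyshev_S (int j) y > chebyshev_S (int j - 1) y"
      "chebyshev_S (int m) y > chebyshev_S (int m - 1) y"
      using chebyshev_S_ratio[of "y - 2" j] chebyshev_S_ratio[of "y - 2" "Suc j"]
        chebyshev_S_ratio[of "y - 2" "Suc (Suc j)"] by (simp_all add: m)
    then show ?thesis
      by (simp add: m)
  next
    case False
    let ?b = "pi / (2 * real m + 1)"
    define a where "a = arccos (y / 2)"
    have b: "0 \<le> ?b" "?b \<le> pi"
      using pi_gt_zero by (simp_all add: divide_simps)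
    have y_bounds: "-1 < y / 2" "y / 2 < 1"
      using cos_ge_minus_one[of ?b] y False by linarith+
    have cos_a: "y = 2 * cos a"
      using y_bounds by (simp add: a_def)
    have a: "0 < a" "a \<le> pi"
      using arccos_lt_bounded[of "y / 2"] y_bounds by (simp_all add: a_def)
    have "a < ?b"
      using cos_mono_less_eq[of ?b a] a b y cos_a by simp
    then have a_less: "(2 * real m + 1) * a < pi"
      by (simp add: field_simps)
    have m_a: "0 < real m * a"
      using a assms(1) by simp
    have "0 < sin a" "0 < sin (a / 2)" "0 < sin (real m * a)"
      using a a_less m_a by (auto intro!: sin_gt_zero simp: algebra_simps)
    moreover have "0 < cos ((2 * real m + 1) * a / 2)"
      using a a_less m_a by (intro cos_gt_zero_pi) (auto simp: algebra_simps)
    moreover have "sin ((real m + 1) * a) - sin (real m * a)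
        = 2 * sin (a / 2) * cos ((2 * real m + 1) * a / 2)"
      using sin_diff_sin[of "(real m + 1) * a" "real m * a"] by (simp add: algebra_simps)
    ultimately have "0 < sin a" "0 < sin (real m * a)"
      "0 < sin ((real m + 1) * a) - sin (real m * a)"
      by simp_all
    then have "0 < sin a" "0 < sin a * chebyshev_S (int m - 1) y"
      "0 < sin a * (chebyshev_S (int m) y - chebyshev_S (int m - 1) y)"
      using sin_times_chebyshev_S[of a m] by (simp_all add: cos_a right_diff_distrib)
    then show ?thesis
      by (simp add: zero_less_mult_iff)
  qed
  then show "chebyshev_S (int m - 1) y > 0" "chebyshev_S (int m) y > chebyshev_S (int m - 1) y"
    by auto
qed

section \<open>Solving the Riley equation\<close>

text \<open>
  Multiplying by \<open>d\<close> clears the denominator of \<open>x - y - 2 = s / d\<^sup>2\<close> in \<open>z\<close>; then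
  \<open>d R = (d - b h\<^sub>n(s)) (S\<^sub>n\<^sub>-\<^sub>1(t) - S\<^sub>n\<^sub>-\<^sub>2(t))\<close>, and the second factor is positive because \<open>t > 2\<close>.
\<close>
lemma riley_poly_eq_0_iff:
  fixes x y :: real and n :: nat and m :: int
  defines "b \<equiv> chebyshev_S (m - 1) y"
  defines "d \<equiv> chebyshev_S m y - chebyshev_S (m - 1) y"
  assumes "b > 0" "d > 0" "x > y + 2"
  shows "riley_poly m (int n) x y = 0 \<longleftrightarrow> chebyshev_ratio n ((x - y - 2) * d\<^sup>2) = d / b"
proof -
  define s where "s = (x - y - 2) * d\<^sup>2"
  define q where "q = chebyshev_S (int n - 1) (s + 2)"
  define r where "r = chebyshev_S (int n - 2) (s + 2)"
  define h where "h = chebyshev_ratio n s"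
  have "s \<ge> 0"
    using assms by (simp add: s_def)
  then have h: "q - r > 0" "h * (q - r) = s * q"
    using chebyshev_S_ratio[of s n] unfolding q_def r_def h_def by auto
  have t: "riley_t m x y = s + 2"
    by (simp add: riley_t_def s_def d_def algebra_simps)
  have z: "d * riley_z m x y = d + (b + d) * s"
    unfolding riley_z_def s_def d_def b_def by (simp add: algebra_simps power2_eq_square)
  have "chebyshev_S (int n) (s + 2) = (s + 2) * q - r"
    unfolding q_def r_def by (rule chebyshev_S_rec)
  then have "riley_poly m (int n) x y = (s + 2) * q - r - riley_z m x y * q"
    unfolding riley_poly_def t by (simp add: q_def)
  then have "d * riley_poly m (int n) x y = d * ((s + 2) * q - r) - (d * riley_z m x y) * q"
    by (simp only: right_diff_distrib mult.assoc)
  also have "\<dots> = d * (q - r) - b * (s * q)"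
    unfolding z by (simp add: algebra_simps)
  also have "\<dots> = (d - b * h) * (q - r)"
    unfolding h(2)[symmetric] by (simp add: algebra_simps)
  finally have "riley_poly m (int n) x y = 0 \<longleftrightarrow> d - b * h = 0"
    using h(1) assms(4) by (metis mult_eq_0_iff less_irrefl)
  also have "\<dots> \<longleftrightarrow> h = d / b"
    using assms(3) by (auto simp: field_simps)
  finally show ?thesis
    by (simp add: h_def s_def)
qed

theorem proposition5p1:
  fixes m n :: int
  assumes "m \<ge> 1" and "n \<ge> 2"
  shows "\<exists>!x :: real \<Rightarrow> real.
    x \<in> {2 * cos (pi / of_int (2 * m + 1))<..} \<rightarrow>\<^sub>E {0<..} \<and>
    continuous_on {2 * cos (pi / of_int (2 * m + 1))<..} x \<and>
    (\<forall>y > 2 * cos (pi / of_int (2 * m + 1)). riley_poly m n (x y) y = 0 \<and> x y > y + 2)"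
proof -
  define c where "c = 2 * cos (pi / of_int (2 * m + 1))"
  define b where "b y = chebyshev_S (m - 1) y" for y :: real
  define d where "d y = chebyshev_S m y - chebyshev_S (m - 1) y" for y :: real
  define k where "k = nat n"
  have k: "n = int k" "k > 0"
    using assms(2) by (simp_all add: k_def)
  have m: "m = int (nat m)"
    using assms(1) by simp
  have c: "c = 2 * cos (pi / (2 * real (nat m) + 1))"
    unfolding c_def by (subst m) simp
  have c_ge: "c \<ge> -2"
    using cos_ge_minus_one[of "pi / of_int (2 * m + 1)"] unfolding c_def by simp
  have pos: "b y > 0" "d y > 0" if "y > c" for y
    using chebyshev_S_pos_right_of_root[of "nat m" y] that assms(1)
    unfolding c b_def d_def by simp_all
  have cont: "continuous_on {c<..} b" "continuous_on {c<..} d"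
    unfolding b_def d_def using continuous_on_chebyshev_S[of "{c<..}" "nat m"] assms(1)
    by (auto intro!: continuous_intros)
  have iff: "riley_poly m n x y = 0 \<longleftrightarrow> chebyshev_ratio k ((x - y - 2) * (d y)\<^sup>2) = d y / b y"
    if "y > c" "x > y + 2" for x y
    using riley_poly_eq_0_iff[of m y x k] pos[OF that(1)] that(2)
    by (simp add: k b_def d_def)
  obtain g where g: "\<And>v. v > 0 \<Longrightarrow> g v > 0" "\<And>v. v > 0 \<Longrightarrow> chebyshev_ratio k (g v) = v"
    "continuous_on {0<..} g"
    using chebyshev_ratio_inverse[OF k(2)] by blast
  define X where "X = restrict (\<lambda>y. y + 2 + g (d y / b y) / (d y)\<^sup>2) {c<..}"
  have X: "X y = y + 2 + g (d y / b y) / (d y)\<^sup>2" if "y > c" for y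
    using that by (simp add: X_def)
  have X_gt: "X y > y + 2" if "y > c" for y
    using that pos[OF that] g(1)[of "d y / b y"] by (simp add: X)
  have X_root: "riley_poly m n (X y) y = 0" if "y > c" for y
    using iff[OF that X_gt[OF that]] pos[OF that] g(2)[of "d y / b y"] by (simp add: X that)
  have X_cont: "continuous_on {c<..} X"
  proof -
    have b: "\<forall>y\<in>{c<..}. b y \<noteq> 0" and d: "\<forall>y\<in>{c<..}. (d y)\<^sup>2 \<noteq> 0"
      using pos by (force+)
    have "continuous_on {c<..} (\<lambda>y. g (d y / b y))"
      by (rule continuous_on_compose2[OF g(3) continuous_on_divide[OF cont(2,1) b]])
        (auto simp: pos)
    then have "continuous_on {c<..} (\<lambda>y. y + 2 + g (d y / b y) / (d y)\<^sup>2)"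
      using cont d by (intro continuous_intros)
    moreover have "continuous_on {c<..} X
        \<longleftrightarrow> continuous_on {c<..} (\<lambda>y. y + 2 + g (d y / b y) / (d y)\<^sup>2)"
      by (rule continuous_on_cong) (simp_all add: X)
    ultimately show ?thesis
      by blast
  qed
  have X_mem: "X \<in> {c<..} \<rightarrow>\<^sub>E {0<..}"
  proof (rule PiE_I)
    show "X y \<in> {0<..}" if "y \<in> {c<..}" for y
      using X_gt[of y] c_ge that by simp
  qed (simp add: X_def)
  have unique: "f = X"
    if "f \<in> {c<..} \<rightarrow>\<^sub>E {0<..}" "\<forall>y>c. riley_poly m n (f y) y = 0 \<and> f y > y + 2" for f
  proof (rule PiE_ext[OF that(1) X_mem])
    fix y assume "y \<in> {c<..}"
    then have y: "y > c"
      by simp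
    let ?s = "\<lambda>x. (x - y - 2) * (d y)\<^sup>2"
    have "chebyshev_ratio k (?s (f y)) = chebyshev_ratio k (?s (X y))"
      using iff[OF y] that(2) X_gt[OF y] X_root[OF y] y by auto
    moreover have "?s (f y) \<ge> 0" "?s (X y) \<ge> 0"
      using that(2) X_gt[OF y] y by (auto simp: less_imp_le)
    ultimately have "?s (f y) = ?s (X y)"
      using chebyshev_ratio_less_iff[OF _ _ k(2)] by (metis less_irrefl linorder_less_linear)
    then show "f y = X y"
      using pos(2)[OF y] by simp
  qed
  show ?thesis
    unfolding c_def[symmetric]
  proof (rule ex1I)
    show "X \<in> {c<..} \<rightarrow>\<^sub>E {0<..} \<and> continuous_on {c<..} X \<and>
        (\<forall>y>c. riley_poly m n (X y) y = 0 \<and> X y > y + 2)"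
      using X_mem X_cont X_root X_gt by blast
  qed (blast intro: unique)
qed

end
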